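(* Let $m,n$ be positive integers and let $a$ be a positive odd integer. Then $$t(a,a,2a,8m;n)=\frac 23N(a,a,2a,8m;8n+8m+4a)-2N(a,a,2a,8m;2n+2m+a).$$
   Context: For positive integers $a,b,c,d$ and a nonnegative integer $n$, $N(a,b,c,d;n)$ denotes the number of $(x,y,z,w)\in\mathbb Z^4$ with $n=ax^2+by^2+cz^2+dw^2$, and $t(a,b,c,d;n)$ denotes the number of $(x,y,z,w)\in\mathbb Z^4$ with $n=a\frac{x(x-1)}2+b\frac{y(y-1)}2+c\frac{z(z-1)}2+d\frac{w(w-1)}2$. *)

theory Defs
  imports Complex_Main
begin

definition quad_rep_set :: "nat \<Rightarrow> nat \<Rightarrow> nat \<Rightarrow> nat \<Rightarrow> nat \<Rightarrow> (int \<times> int \<times> int \<times> int) set" where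
  "quad_rep_set a b c d n =
     {(x, y, z, w). int n = int a * x\<^sup>2 + int b * y\<^sup>2 + int c * z\<^sup>2 + int d * w\<^sup>2}"

definition N :: "nat \<Rightarrow> nat \<Rightarrow> nat \<Rightarrow> nat \<Rightarrow> nat \<Rightarrow> nat" where
  "N a b c d n = card (quad_rep_set a b c d n)"

(* The divisions by 2 are exact, since x * (x - 1) is always even. *)
definition tri_rep_set :: "nat \<Rightarrow> nat \<Rightarrow> nat \<Rightarrow> nat \<Rightarrow> nat \<Rightarrow> (int \<times> int \<times> int \<times> int) set" where
  "tri_rep_set a b c d n =
     {(x, y, z, w). int n = int a * (x * (x - 1) div 2) + int b * (y * (y - 1) div 2)
        + int c * (z * (z - 1) div 2) + int d * (w * (w - 1) div 2)}"

definition t :: "nat \<Rightarrow> nat \<Rightarrow> nat \<Rightarrow> nat \<Rightarrow> nat \<Rightarrow> nat" where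
  "t a b c d n = card (tri_rep_set a b c d n)"

(* For positive coefficients both sets are finite, so card is the true count. *)

lemma sq_term_bound:
  fixes x k r :: int
  assumes "k > 0" "k * x\<^sup>2 \<le> r"
  shows "x \<in> {-r..r}"
proof -
  have "\<bar>x\<bar> * 1 \<le> \<bar>x\<bar> * \<bar>x\<bar>"
  proof (cases "x = 0")
    case False
    then show ?thesis by (intro mult_left_mono) linarith+
  qed simp
  then have "\<bar>x\<bar> \<le> x\<^sup>2" by (simp add: power2_eq_square)
  moreover have "1 * x\<^sup>2 \<le> k * x\<^sup>2" using assms by (intro mult_right_mono) auto
  ultimately show ?thesis using assms by auto
qed

lemma tri_term_nonneg: "0 \<le> x * (x - 1) div (2::int)"
proof -
  have "0 \<le> x * (x - 1)" by (cases "x \<le> 0") (auto intro: mult_nonpos_nonpos)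
  then show ?thesis by simp
qed

lemma tri_term_bound:
  fixes x k r :: int
  assumes "k > 0" "k * (x * (x - 1) div 2) \<le> r"
  shows "x \<in> {-r-1..r+1}"
proof -
  have "1 * (x * (x - 1) div 2) \<le> k * (x * (x - 1) div 2)"
    using assms tri_term_nonneg by (intro mult_right_mono) auto
  then have "x * (x - 1) div 2 \<le> r" using assms by linarith
  moreover have "2 * (x * (x - 1) div 2) = x * (x - 1)" by (intro dvd_mult_div_cancel) simp
  ultimately have le: "x * (x - 1) \<le> 2 * r" by linarith
  have "0 \<le> (x - 1) * (x - 2)"
    by (cases "x \<le> 1") (auto intro: mult_nonpos_nonpos)
  then have "2 * x - 2 \<le> x * (x - 1)" by (simp add: algebra_simps)
  moreover have "0 \<le> (x + 1) * x"
    by (cases "x \<ge> 0") (auto intro: mult_nonpos_nonpos)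
  then have "- 2 * x \<le> x * (x - 1)" by (simp add: algebra_simps)
  ultimately show ?thesis using le by auto
qed

lemma finite_quad_rep_set:
  assumes "a > 0" "b > 0" "c > 0" "d > 0"
  shows "finite (quad_rep_set a b c d n)"
proof (rule finite_subset)
  let ?I = "{- int n..int n}"
  show "finite (?I \<times> ?I \<times> ?I \<times> ?I)" by simp
  show "quad_rep_set a b c d n \<subseteq> ?I \<times> ?I \<times> ?I \<times> ?I"
  proof (clarify, goal_cases)
    case (1 x y z w)
    have nn: "0 \<le> int k * u\<^sup>2" for k u by simp
    have eq: "int n = int a * x\<^sup>2 + int b * y\<^sup>2 + int c * z\<^sup>2 + int d * w\<^sup>2"
      using 1 by (simp add: quad_rep_set_def)
    have "int a * x\<^sup>2 \<le> int n" "int b * y\<^sup>2 \<le> int n" "int c * z\<^sup>2 \<le> int n" "int d * w\<^sup>2 \<le> int n"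
      using eq nn[of a x] nn[of b y] nn[of c z] nn[of d w] by linarith+
    then show ?case using assms
      by (intro conjI SigmaI; intro sq_term_bound) simp_all
  qed
qed

lemma finite_tri_rep_set:
  assumes "a > 0" "b > 0" "c > 0" "d > 0"
  shows "finite (tri_rep_set a b c d n)"
proof (rule finite_subset)
  let ?I = "{- int n - 1..int n + 1}"
  show "finite (?I \<times> ?I \<times> ?I \<times> ?I)" by simp
  show "tri_rep_set a b c d n \<subseteq> ?I \<times> ?I \<times> ?I \<times> ?I"
  proof (clarify, goal_cases)
    case (1 x y z w)
    have nn: "0 \<le> int k * (u * (u - 1) div 2)" for k u
      using tri_term_nonneg by simp
    have eq: "int n = int a * (x * (x - 1) div 2) + int b * (y * (y - 1) div 2)
        + int c * (z * (z - 1) div 2) + int d * (w * (w - 1) div 2)"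
      using 1 by (simp add: tri_rep_set_def)
    have "int a * (x * (x - 1) div 2) \<le> int n" "int b * (y * (y - 1) div 2) \<le> int n"
      "int c * (z * (z - 1) div 2) \<le> int n" "int d * (w * (w - 1) div 2) \<le> int n"
      using eq nn[of a x] nn[of b y] nn[of c z] nn[of d w] by linarith+
    then show ?case using assms
      by (intro conjI SigmaI; intro tri_term_bound) simp_all
  qed
qed

end

theory Submission
  imports Defs "HOL-Library.FuncSet"
begin

text \<open>
  Write \<open>M = 8n + 8m + 4a\<close>. Completing squares turns \<open>t\<close> into the number of representations of \<open>M\<close>
  with all four variables odd. In any representation \<open>(x, y, z, w)\<close> of \<open>M\<close> the integers \<open>x, y, z\<close>
  have the same parity, and those with \<open>x, y, z, w\<close> all even are the doubled representations of
  \<open>M / 4\<close>. The involutive isometry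
  \<open>(x, y, z) \<mapsto> ((x + y) / 2 + z, (x + y) / 2 - z, (x - y) / 2)\<close> of \<open>x\<^sup>2 + y\<^sup>2 + 2 z\<^sup>2\<close> exchanges
  the representations with \<open>x\<close> even and those with \<open>x\<close> odd and \<open>x + y \<equiv> 2 (mod 4)\<close>, which are
  half of those with \<open>x\<close> odd, because \<open>y \<mapsto> - y\<close> exchanges the two classes of \<open>x + y\<close> modulo 4.
  So for each parity of \<open>w\<close> the odd representations are twice as many as the even ones.
\<close>

lemma funcset_quadrupleI:
  assumes "\<And>x y z w. (x, y, z, w) \<in> A \<Longrightarrow> f (x, y, z, w) \<in> B"
  shows "f \<in> A \<rightarrow> B"
  using assms by (intro funcsetI) (metis prod_cases4)

text \<open>For \<open>x = 4 * q + r\<close> the square is \<open>r * r\<close> modulo 8, so the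
  residue of \<open>x\<close> modulo 4 decides. Even \<open>x\<close> is split further because the
  classes 0 and 2 modulo 4 must be told apart in \<open>quad_rep_parity\<close>.\<close>

lemma square_mod_8:
  fixes x :: int
  shows "x\<^sup>2 mod 8 = (if odd x then 1 else if x mod 4 = 2 then 4 else 0)"
proof -
  define q where "q = x div 4"
  have "x = 4 * q + x mod 4" by (simp add: q_def)
  moreover have "x mod 4 = 0 \<or> x mod 4 = 1 \<or> x mod 4 = 2 \<or> x mod 4 = 3" by presburger
  ultimately consider "x = 4 * q" | "x = 4 * q + 1" | "x = 4 * q + 2" | "x = 4 * q + 3" by force
  then show ?thesis
  proof cases
    case 1
    have "x\<^sup>2 = 8 * (2 * q\<^sup>2)" by (simp add: 1 power2_eq_square)
    with 1 show ?thesis by simp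
  next
    case 2
    have "x\<^sup>2 = 8 * (2 * q\<^sup>2 + q) + 1" by (simp add: 2 power2_eq_square algebra_simps)
    then have "x\<^sup>2 mod 8 = 1" by (simp only: mod_mult_self4) simp
    moreover have "odd x" by (simp_all add: 2)
    ultimately show ?thesis by simp
  next
    case 3
    have "x\<^sup>2 = 8 * (2 * q\<^sup>2 + 2 * q) + 4" by (simp add: 3 power2_eq_square algebra_simps)
    then have "x\<^sup>2 mod 8 = 4" by (simp only: mod_mult_self4) simp
    moreover have "even x" "x mod 4 = 2" by (simp_all add: 3)
    ultimately show ?thesis by simp
  next
    case 4
    have "x\<^sup>2 = 8 * (2 * q\<^sup>2 + 3 * q + 1) + 1" by (simp add: 4 power2_eq_square algebra_simps)
    then have "x\<^sup>2 mod 8 = 1" by (simp only: mod_mult_self4) simp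
    moreover have "odd x" by (simp_all add: 4)
    ultimately show ?thesis by simp
  qed
qed

text \<open>An odd \<open>a\<close> is invertible modulo 8, which leaves x^2 + y^2 + 2 z^2 congruent
  to 4 modulo 8; comparing the possible residues of squares settles the parities.\<close>

lemma quad_rep_parity:
  assumes "odd a" and "(x, y, z, w) \<in> quad_rep_set a a (2 * a) (8 * m) (8 * k + 4 * a)"
  shows "odd x \<and> odd y \<and> odd z \<or> even x \<and> even y \<and> even z \<and> (x + y) mod 4 = 2"
proof -
  have "int a * (x\<^sup>2 + y\<^sup>2 + 2 * z\<^sup>2 - 4) = 8 * (int k - int m * w\<^sup>2)"
    using assms(2) by (simp add: quad_rep_set_def algebra_simps)
  then have "8 dvd int a * (x\<^sup>2 + y\<^sup>2 + 2 * z\<^sup>2 - 4)" by simp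
  moreover have "coprime (2 ^ 3 :: int) (int a)"
    using assms(1) by (subst coprime_power_left_iff) simp
  then have "coprime 8 (int a)" by simp
  ultimately have "8 dvd x\<^sup>2 + y\<^sup>2 + 2 * z\<^sup>2 - 4"
    using coprime_dvd_mult_right_iff by blast
  then have "(x\<^sup>2 + y\<^sup>2 + 2 * z\<^sup>2) mod 8 = 4" by presburger
  then have "(x\<^sup>2 mod 8 + y\<^sup>2 mod 8 + 2 * (z\<^sup>2 mod 8)) mod 8 = 4"
    by (metis mod_add_eq mod_mult_right_eq)
  \<comment> \<open>If \<open>x\<close>, \<open>y\<close>, \<open>z\<close> are even, 2 z^2 vanishes
    modulo 8, so x^2 + y^2 is 4 modulo 8 and exactly one of \<open>x\<close>, \<open>y\<close> is 2
    modulo 4.\<close>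
  then have "odd x \<and> odd y \<and> odd z \<or> even x \<and> even y \<and> even z \<and> (x mod 4 = 2 \<longleftrightarrow> y mod 4 \<noteq> 2)"
    unfolding square_mod_8 by (simp split: if_splits)
  then show ?thesis by presburger
qed

text \<open>In the coordinates p = (x + y) / 2, q = (x - y) / 2 the form x^2 + y^2 + 2 z^2 becomes 2
  (p^2 + q^2 + z^2), and the map merely swaps q and z. Hence it is an involution and preserves the
  form.\<close>

lemma isometry_twice:
  fixes x y z :: int
  assumes "even (x + y)"
  defines "x' \<equiv> (x + y) div 2 + z" and "y' \<equiv> (x + y) div 2 - z" and "z' \<equiv> (x - y) div 2"
  shows "(x' + y') div 2 + z' = x" "(x' + y') div 2 - z' = y" "(x' - y') div 2 = z"
    and "x'\<^sup>2 + y'\<^sup>2 + 2 * z'\<^sup>2 = x\<^sup>2 + y\<^sup>2 + 2 * z\<^sup>2"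
proof -
  define p q where "p = (x + y) div 2" and "q = (x - y) div 2"
  have xy: "x = p + q" "y = p - q" using assms(1) unfolding p_def q_def by presburger+
  show "(x' + y') div 2 + z' = x" "(x' + y') div 2 - z' = y" "(x' - y') div 2 = z"
    "x'\<^sup>2 + y'\<^sup>2 + 2 * z'\<^sup>2 = x\<^sup>2 + y\<^sup>2 + 2 * z\<^sup>2"
    unfolding x'_def y'_def z'_def xy by (simp_all add: power2_eq_square algebra_simps)
qed

text \<open>The maps \<open>?f\<close> and \<open>?g\<close> both fix \<open>w\<close>, so the count
  may be restricted by any condition \<open>P\<close> on \<open>w\<close>. The trivial condition and
  oddness of \<open>w\<close> are the instances used later.\<close>

lemma card_odd_reps_eq_twice_even_reps:
  fixes P :: "int \<Rightarrow> bool" and a m k :: nat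
  assumes "a > 0" "m > 0" "odd a"
  defines "S \<equiv> quad_rep_set a a (2 * a) (8 * m) (8 * k + 4 * a)"
  shows "card {(x, y, z, w) \<in> S. odd x \<and> P w} = 2 * card {(x, y, z, w) \<in> S. even x \<and> P w}"
proof -
  let ?O = "\<lambda>r. {(x, y, z, w) \<in> S. odd x \<and> (x + y) mod 4 = r \<and> P w}"
  let ?E = "{(x, y, z, w) \<in> S. even x \<and> P w}"
  let ?f = "\<lambda>(x, y, z, w). ((x + y) div 2 + z, (x + y) div 2 - z, (x - y) div 2, w) :: int \<times> int \<times> int \<times> int"
  let ?g = "\<lambda>(x, y, z, w). (x, - y, z, w) :: int \<times> int \<times> int \<times> int"
  have fin: "finite S" using assms by (simp add: finite_quad_rep_set)
  have par: "odd x \<and> odd y \<and> odd z \<or> even x \<and> even y \<and> even z \<and> (x + y) mod 4 = 2"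
    if "(x, y, z, w) \<in> S" for x y z w
    using quad_rep_parity that assms by blast
  have S_iff: "(x, y, z, w) \<in> S \<longleftrightarrow>
      int (8 * k + 4 * a) = int a * (x\<^sup>2 + y\<^sup>2 + 2 * z\<^sup>2) + 8 * int m * w\<^sup>2" for x y z w
    by (simp add: S_def quad_rep_set_def algebra_simps)
  have f_S: "?f (x, y, z, w) \<in> S" if "(x, y, z, w) \<in> S" for x y z w
  proof -
    have "even (x + y)" using par[OF that] by auto
    with that show ?thesis by (simp only: S_iff prod.case isometry_twice(4))
  qed
  have f_f: "?f (?f (x, y, z, w)) = (x, y, z, w)" if "(x, y, z, w) \<in> S" for x y z w
  proof -
    have "even (x + y)" using par[OF that] by auto
    then show ?thesis by (simp only: prod.case isometry_twice(1-3))
  qed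
  have "bij_betw ?f (?O 2) ?E"
  proof (rule bij_betwI[where g = ?f])
    have "?f (x, y, z, w) \<in> ?E" if "(x, y, z, w) \<in> ?O 2" for x y z w
    proof -
      have *: "(x, y, z, w) \<in> S" "odd x" "(x + y) mod 4 = 2" "P w" using that by auto
      \<comment> \<open>Both summands are odd: the first because \<open>x + y\<close> is 2 modulo 4,
        the second by parity.\<close>
      have "even ((x + y) div 2 + z)" using par[OF *(1)] *(2,3) by presburger
      then show ?thesis using f_S[OF *(1)] *(4) by simp
    qed
    then show "?f \<in> ?O 2 \<rightarrow> ?E" by (rule funcset_quadrupleI)
    have "?f (x, y, z, w) \<in> ?O 2" if "(x, y, z, w) \<in> ?E" for x y z w
    proof -
      have *: "(x, y, z, w) \<in> S" "even x" "P w" using that by auto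
      \<comment> \<open>Now \<open>z\<close> is even while \<open>(x + y) div 2\<close> is still
        odd. The sum of the first two coordinates is unchanged by \<open>?f\<close>, hence again 2
        modulo 4.\<close>
      have "odd ((x + y) div 2 + z)" "((x + y) div 2 + z + ((x + y) div 2 - z)) mod 4 = 2"
        using par[OF *(1)] *(2) by presburger+
      then show ?thesis using f_S[OF *(1)] *(3) by simp
    qed
    then show "?f \<in> ?E \<rightarrow> ?O 2" by (rule funcset_quadrupleI)
    show "?f (?f p) = p" if "p \<in> ?O 2" for p using that f_f by (cases p) blast
    show "?f (?f p) = p" if "p \<in> ?E" for p using that f_f by (cases p) blast
  qed
  then have O2: "card (?O 2) = card ?E" by (rule bij_betw_same_card)
  have g_S: "?g (x, y, z, w) \<in> S" if "(x, y, z, w) \<in> S" for x y z w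
    using that by (simp add: S_iff)
  have "bij_betw ?g (?O 0) (?O 2)"
  proof (rule bij_betwI[where g = ?g])
    have g_O: "?g (x, y, z, w) \<in> ?O r'" if "(x, y, z, w) \<in> ?O r" "r = 0 \<and> r' = 2 \<or> r = 2 \<and> r' = 0"
      for x y z w r r'
    proof -
      have *: "(x, y, z, w) \<in> S" "odd x" "(x + y) mod 4 = r" "P w" using that(1) by auto
      \<comment> \<open>As \<open>y\<close> is odd, x - y and x + y differ by 2 y, which is 2 modulo
        4.\<close>
      have "(x + - y) mod 4 = r'" using *(2,3) that(2) by presburger
      then show ?thesis using g_S[OF *(1)] *(2,4) by simp
    qed
    show "?g \<in> ?O 0 \<rightarrow> ?O 2" by (rule funcset_quadrupleI, erule g_O) simp
    show "?g \<in> ?O 2 \<rightarrow> ?O 0" by (rule funcset_quadrupleI, erule g_O) simp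
  qed auto
  then have O0: "card (?O 0) = card (?O 2)" by (rule bij_betw_same_card)
  have split: "(x + y) mod 4 = 0 \<or> (x + y) mod 4 = 2" if "(x, y, z, w) \<in> S" "odd x" for x y z w
    using par[OF that(1)] that(2) by presburger
  have "{(x, y, z, w) \<in> S. odd x \<and> P w} = ?O 0 \<union> ?O 2"
    using split by blast
  moreover have "card (?O 0 \<union> ?O 2) = card (?O 0) + card (?O 2)"
    by (rule card_Un_disjoint) (auto intro: finite_subset[OF _ fin])
  ultimately show ?thesis using O0 O2 by simp
qed

text \<open>Multiplying the equation by 8 and completing squares gives odd variables 2 x - 1 and so
  on. Requiring \<open>x\<close> and \<open>w\<close> odd suffices, since \<open>y\<close> and
  \<open>z\<close> share the parity of \<open>x\<close>.\<close>

lemma t_eq_card_odd_reps: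
  assumes "odd a"
  shows "t a a (2 * a) (8 * m) n =
    card {(x, y, z, w) \<in> quad_rep_set a a (2 * a) (8 * m) (8 * (n + m) + 4 * a). odd x \<and> odd w}"
    (is "_ = card ?O")
proof -
  let ?f = "\<lambda>(x, y, z, w). (2 * x - 1, 2 * y - 1, 2 * z - 1, 2 * w - 1) :: int \<times> int \<times> int \<times> int"
  let ?g = "\<lambda>(x, y, z, w). ((x + 1) div 2, (y + 1) div 2, (z + 1) div 2, (w + 1) div 2)
    :: int \<times> int \<times> int \<times> int"
  have sq: "(2 * x - 1)\<^sup>2 = 8 * (x * (x - 1) div 2) + 1" for x :: int
  proof -
    have "2 * (x * (x - 1) div 2) = x * (x - 1)" by (intro dvd_mult_div_cancel) simp
    moreover have "(2 * x - 1)\<^sup>2 = 4 * (x * (x - 1)) + 1"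
      by (simp add: power2_eq_square algebra_simps)
    ultimately show ?thesis by linarith
  qed
  have f_iff: "?f (x, y, z, w) \<in> ?O \<longleftrightarrow> (x, y, z, w) \<in> tri_rep_set a a (2 * a) (8 * m) n" for x y z w
  proof -
    let ?T = "int a * (x * (x - 1) div 2) + int a * (y * (y - 1) div 2)
        + int (2 * a) * (z * (z - 1) div 2) + int (8 * m) * (w * (w - 1) div 2)"
    \<comment> \<open>The constant \<open>8 * m + 4 * a\<close> is the sum of the four coefficients,
      each contributed by the \<open>+ 1\<close> in \<open>sq\<close>.\<close>
    have cancel: "int (8 * (n + m) + 4 * a) = 8 * T + int (8 * m + 4 * a) \<longleftrightarrow> int n = T" for T
      by auto
    have "?f (x, y, z, w) \<in> ?O \<longleftrightarrow> int (8 * (n + m) + 4 * a) = int a * (2 * x - 1)\<^sup>2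
        + int a * (2 * y - 1)\<^sup>2 + int (2 * a) * (2 * z - 1)\<^sup>2 + int (8 * m) * (2 * w - 1)\<^sup>2"
      by (simp add: quad_rep_set_def)
    also have "int a * (2 * x - 1)\<^sup>2 + int a * (2 * y - 1)\<^sup>2 + int (2 * a) * (2 * z - 1)\<^sup>2
        + int (8 * m) * (2 * w - 1)\<^sup>2 = 8 * ?T + int (8 * m + 4 * a)"
      unfolding sq by (simp add: algebra_simps)
    also have "int (8 * (n + m) + 4 * a) = 8 * ?T + int (8 * m + 4 * a) \<longleftrightarrow> int n = ?T"
      by (rule cancel)
    finally show ?thesis by (simp add: tri_rep_set_def)
  qed
  have f_g: "?f (?g (x, y, z, w)) = (x, y, z, w)" if "(x, y, z, w) \<in> ?O" for x y z w
  proof -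
    have "odd x" "odd y" "odd z" "odd w" using that quad_rep_parity[OF assms] by blast+
    then show ?thesis by simp presburger
  qed
  have "bij_betw ?f (tri_rep_set a a (2 * a) (8 * m) n) ?O"
  proof (rule bij_betwI[where g = ?g])
    show "?f \<in> tri_rep_set a a (2 * a) (8 * m) n \<rightarrow> ?O"
      by (rule funcset_quadrupleI) (rule f_iff[THEN iffD2])
    show "?g \<in> ?O \<rightarrow> tri_rep_set a a (2 * a) (8 * m) n"
    proof (rule funcset_quadrupleI)
      fix x y z w assume *: "(x, y, z, w) \<in> ?O"
      then have "?f (?g (x, y, z, w)) \<in> ?O" by (subst f_g)
      then show "?g (x, y, z, w) \<in> tri_rep_set a a (2 * a) (8 * m) n"
        using f_iff[of "(x + 1) div 2" "(y + 1) div 2" "(z + 1) div 2" "(w + 1) div 2"] by simp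
    qed
    show "?f (?g p) = p" if "p \<in> ?O" for p using that f_g by (cases p) blast
  qed auto
  then show ?thesis unfolding t_def by (rule bij_betw_same_card)
qed

text \<open>Doubling all variables multiplies the represented number by 4. It reaches every
  representation with \<open>x\<close> and \<open>w\<close> even, because \<open>y\<close> and
  \<open>z\<close> are then even too.\<close>

lemma N_eq_card_even_reps:
  assumes "odd a"
  shows "N a a (2 * a) (8 * m) (2 * k + a) =
    card {(x, y, z, w) \<in> quad_rep_set a a (2 * a) (8 * m) (8 * k + 4 * a). even x \<and> even w}"
    (is "_ = card ?E")
proof -
  let ?f = "\<lambda>(x, y, z, w). (2 * x, 2 * y, 2 * z, 2 * w) :: int \<times> int \<times> int \<times> int"
  let ?Q = "quad_rep_set a a (2 * a) (8 * m) (2 * k + a)"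
  have f_iff: "?f (x, y, z, w) \<in> ?E \<longleftrightarrow> (x, y, z, w) \<in> ?Q" for x y z w
  proof -
    let ?T = "int a * x\<^sup>2 + int a * y\<^sup>2 + int (2 * a) * z\<^sup>2 + int (8 * m) * w\<^sup>2"
    have cancel: "int (8 * k + 4 * a) = 4 * T \<longleftrightarrow> int (2 * k + a) = T" for T
      by auto
    have "?f (x, y, z, w) \<in> ?E \<longleftrightarrow> int (8 * k + 4 * a) = int a * (2 * x)\<^sup>2
        + int a * (2 * y)\<^sup>2 + int (2 * a) * (2 * z)\<^sup>2 + int (8 * m) * (2 * w)\<^sup>2"
      by (simp add: quad_rep_set_def)
    also have "int a * (2 * x)\<^sup>2 + int a * (2 * y)\<^sup>2 + int (2 * a) * (2 * z)\<^sup>2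
        + int (8 * m) * (2 * w)\<^sup>2 = 4 * ?T"
      by (simp add: power_mult_distrib algebra_simps)
    also have "int (8 * k + 4 * a) = 4 * ?T \<longleftrightarrow> int (2 * k + a) = ?T"
      by (rule cancel)
    finally show ?thesis by (simp add: quad_rep_set_def)
  qed
  have "?f ` ?Q = ?E"
  proof (rule equalityI)
    show "?f ` ?Q \<subseteq> ?E"
      unfolding image_subset_iff_funcset
      by (rule funcset_quadrupleI) (rule f_iff[THEN iffD2])
    show "?E \<subseteq> ?f ` ?Q"
    proof (rule subsetI)
      fix p assume p: "p \<in> ?E"
      obtain x y z w where xyzw: "p = (x, y, z, w)" by (cases p)
      have "even x" "even y" "even z" "even w"
        using p quad_rep_parity[OF assms] unfolding xyzw by blast+
      then have eq: "p = ?f (x div 2, y div 2, z div 2, w div 2)" by (simp add: xyzw)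
      have "(x div 2, y div 2, z div 2, w div 2) \<in> ?Q"
        using p unfolding eq by (rule f_iff[THEN iffD1])
      then show "p \<in> ?f ` ?Q" unfolding eq by (rule imageI)
    qed
  qed
  moreover have "inj_on ?f ?Q" by (auto simp: inj_on_def)
  ultimately have "bij_betw ?f ?Q ?E" by (intro bij_betw_imageI)
  then show ?thesis unfolding N_def by (rule bij_betw_same_card)
qed

theorem theorem2p1:
  fixes a m n :: nat
  assumes "m > 0" and "n > 0" and "a > 0" and "odd a"
  shows "real (t a a (2 * a) (8 * m) n) =
    2 / 3 * real (N a a (2 * a) (8 * m) (8 * n + 8 * m + 4 * a))
      - 2 * real (N a a (2 * a) (8 * m) (2 * n + 2 * m + a))"
proof -
  define S where "S = quad_rep_set a a (2 * a) (8 * m) (8 * (n + m) + 4 * a)"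
  let ?O = "\<lambda>P. {(x, y, z, w) \<in> S. odd x \<and> P w}"
  let ?E = "\<lambda>P. {(x, y, z, w) \<in> S. even x \<and> P w}"
  have fin: "finite S" using assms by (simp add: S_def finite_quad_rep_set)
  have double: "card (?O P) = 2 * card (?E P)" for P
    unfolding S_def using assms by (intro card_odd_reps_eq_twice_even_reps)
  have "card (?O (\<lambda>_. True) \<union> ?E (\<lambda>_. True)) = card (?O (\<lambda>_. True)) + card (?E (\<lambda>_. True))"
    by (rule card_Un_disjoint) (auto intro: finite_subset[OF _ fin])
  moreover have "card (?O (\<lambda>_. True) \<union> ?E (\<lambda>_. True)) = card S"
    by (rule arg_cong[where f = card]) auto
  ultimately have S: "card S = 3 * card (?E (\<lambda>_. True))"
    using double[of "\<lambda>_. True"] by linarith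
  have "card (?E even \<union> ?E odd) = card (?E even) + card (?E odd)"
    by (rule card_Un_disjoint) (auto intro: finite_subset[OF _ fin])
  moreover have "card (?E even \<union> ?E odd) = card (?E (\<lambda>_. True))"
    by (rule arg_cong[where f = card]) auto
  ultimately have E: "card (?E (\<lambda>_. True)) = card (?E even) + card (?E odd)" by linarith
  have t_eq: "t a a (2 * a) (8 * m) n = 2 * card (?E odd)"
    using t_eq_card_odd_reps[OF assms(4)] double[of odd] by (simp add: S_def)
  have N_eq: "N a a (2 * a) (8 * m) (8 * n + 8 * m + 4 * a) = card S"
    by (simp add: N_def S_def)
  have N_even: "N a a (2 * a) (8 * m) (2 * n + 2 * m + a) = card (?E even)"
    using N_eq_card_even_reps[OF assms(4), of m "n + m"] by (simp add: S_def)
  \<comment> \<open>Here \<open>p\<close> and \<open>q\<close> stand for the numbers of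
    representations with \<open>x\<close> even and \<open>w\<close> even or odd,
    respectively.\<close>
  have "real (2 * q) = 2 / 3 * real (3 * (p + q)) - 2 * real p" for p q
    by (simp add: field_simps)
  then show ?thesis unfolding t_eq N_eq N_even S E .
qed

end
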